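(* Let $A$ be a finite-dimensional real alternative algebra with unity and a fixed antiinvolution, with $\mathbb{S}_A\neq\emptyset$. Let $f$ be a slice function on $\Omega_D$. Let $J,K\in\mathbb{S}_A$ with $J-K$ invertible. Then the following formula holds: \[f(x)=(I-K)\left((J-K)^{-1}f(\alpha+\beta J)\right)-(I-J)\left((J-K)^{-1}f(\alpha+\beta K)\right)\] for every $I\in\mathbb{S}_A$ and for every $x=\alpha+\beta I\in D_I=\Omega_D\cap\mathbb{C}_I$ ($\alpha,\beta\in\mathbb{R}$). In particular, for $K=-J$, \[f(x)=\frac12\left(f(\alpha+\beta J)+f(\alpha-\beta J)\right)-\frac{I}2\left(J\left(f(\alpha+\beta J)-f(\alpha-\beta J)\right)\right).\]
   Context: Setting. $A$ is a finite-dimensional real alternative algebra with unity, of real dimension $d>1$ (alternative: the associator $(x,y,z)=(xy)z-x(yz)$ is alternating); $\mathbb{R}$ is identified with $\mathbb{R}\cdot 1\subseteq A$. An antiinvolution $x\mapsto x^c$ is fixed: a linear map with $(x^c)^c=x$, $(xy)^c=y^cx^c$, and $x^c=x$ for $x\in\mathbb{R}$. Put $t(x)=x+x^c$, $n(x)=xx^c$. Quadratic cone: $Q_A=\mathbb{R}\cup\{x\in A\mid t(x)\in\mathbb{R},\ n(x)\in\mathbb{R},\ 4n(x)>t(x)^2\}$. $\mathbb{S}_A=\{J\in Q_A\mid J^2=-1\}$, assumed non-empty. For $J\in\mathbb{S}_A$, $\mathbb{C}_J=\langle 1,J\rangle\simeq\mathbb{C}$. Slice functions. $A_{\mathbb{C}}=A\otimes_{\mathbb{R}}\mathbb{C}=\{x+iy\mid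 x,y\in A\}$ with conjugation $\overline{x+iy}=x-iy$. $D\subseteq\mathbb{C}$ is open and, without restriction, invariant under complex conjugation. A stem function on $D$ is $F=F_1+iF_2:D\to A_{\mathbb{C}}$ ($F_1,F_2$ $A$-valued) with $F(\bar z)=\overline{F(z)}$. Let $\Omega_D=\{\alpha+\beta J\mid \alpha,\beta\in\mathbb{R},\ \alpha+i\beta\in D,\ J\in\mathbb{S}_A\}$. The (left) slice function $f=\mathcal{I}(F):\Omega_D\to A$ induced by $F$ is $f(\alpha+\beta J)=F_1(\alpha+i\beta)+JF_2(\alpha+i\beta)$. *)

theory Defs
  imports Complex_Main
begin

text \<open>The distribution's algebra classes all presuppose associativity, so multiplication and unit
  are added directly to \<^class>\<open>real_vector\<close>. The real number \<open>r\<close>, seen as an element of the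
  algebra, is \<open>r *\<^sub>R 1\<close>.\<close>

class unital_real_algebra = real_vector + one + times +
  assumes alt_distrib_right: "(x + y) * z = x * z + y * z"
    and alt_distrib_left: "x * (y + z) = x * y + x * z"
    and alt_scaleR_left: "(r *\<^sub>R x) * y = r *\<^sub>R (x * y)"
    and alt_scaleR_right: "x * (r *\<^sub>R y) = r *\<^sub>R (x * y)"
    and alt_one_left: "1 * x = x"
    and alt_one_right: "x * 1 = x"

definition (in unital_real_algebra) associator :: "'a \<Rightarrow> 'a \<Rightarrow> 'a \<Rightarrow> 'a" where
  "associator x y z = (x * y) * z - x * (y * z)"

class real_alternative_algebra = unital_real_algebra +
  assumes associator_left: "associator x x y = 0"
    and associator_right: "associator x y y = 0"
    and associator_outer: "associator x y x = 0"

text \<open>Two-sided inverses in an alternative algebra are unique, so the description below is proper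
  whenever \<open>x\<close> is invertible.\<close>

definition alt_invertible :: "'a::real_alternative_algebra \<Rightarrow> bool" where
  "alt_invertible x \<longleftrightarrow> (\<exists>y. x * y = 1 \<and> y * x = 1)"

definition alt_inverse :: "'a::real_alternative_algebra \<Rightarrow> 'a" where
  "alt_inverse x = (THE y. x * y = 1 \<and> y * x = 1)"

definition antiinvolution :: "('a::real_alternative_algebra \<Rightarrow> 'a) \<Rightarrow> bool" where
  "antiinvolution c \<longleftrightarrow> linear c \<and> (\<forall>x. c (c x) = x) \<and> (\<forall>x y. c (x * y) = c y * c x) \<and>
     (\<forall>r. c (r *\<^sub>R 1) = r *\<^sub>R 1)"

definition quadratic_cone :: "('a::real_alternative_algebra \<Rightarrow> 'a) \<Rightarrow> 'a set" where
  "quadratic_cone c = range (\<lambda>r. r *\<^sub>R 1) \<union>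
     {x. \<exists>t n. x + c x = t *\<^sub>R 1 \<and> x * c x = n *\<^sub>R 1 \<and> 4 * n > t\<^sup>2}"

definition imag_units :: "('a::real_alternative_algebra \<Rightarrow> 'a) \<Rightarrow> 'a set" where
  "imag_units c = {J \<in> quadratic_cone c. J * J = - 1}"

definition complex_plane :: "'a::real_alternative_algebra \<Rightarrow> 'a set" where
  "complex_plane J = span {1, J}"

text \<open>The element \<open>x + i y\<close> of the complexified algebra is encoded as the pair \<open>(x, y)\<close>.\<close>

definition complexified_cnj :: "'a::real_alternative_algebra \<times> 'a \<Rightarrow> 'a \<times> 'a" where
  "complexified_cnj w = (fst w, - snd w)"

definition stem_function ::
    "complex set \<Rightarrow> (complex \<Rightarrow> 'a::real_alternative_algebra \<times> 'a) \<Rightarrow> bool" where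
  "stem_function D F \<longleftrightarrow> (\<forall>z\<in>D. F (cnj z) = complexified_cnj (F z))"

definition slice_domain ::
    "('a::real_alternative_algebra \<Rightarrow> 'a) \<Rightarrow> complex set \<Rightarrow> 'a set" where
  "slice_domain c D =
     {\<alpha> *\<^sub>R 1 + \<beta> *\<^sub>R J | \<alpha> \<beta> J. Complex \<alpha> \<beta> \<in> D \<and> J \<in> imag_units c}"

text \<open>Functions on the slice domain are total functions whose values elsewhere are irrelevant.\<close>

definition induced_by ::
    "('a::real_alternative_algebra \<Rightarrow> 'a) \<Rightarrow> complex set \<Rightarrow> (complex \<Rightarrow> 'a \<times> 'a) \<Rightarrow>
     ('a \<Rightarrow> 'a) \<Rightarrow> bool" where
  "induced_by c D F f \<longleftrightarrow>
     (\<forall>\<alpha> \<beta>. \<forall>J\<in>imag_units c. Complex \<alpha> \<beta> \<in> D \<longrightarrow>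
        f (\<alpha> *\<^sub>R 1 + \<beta> *\<^sub>R J) = fst (F (Complex \<alpha> \<beta>)) + J * snd (F (Complex \<alpha> \<beta>)))"

definition slice_function ::
    "('a::real_alternative_algebra \<Rightarrow> 'a) \<Rightarrow> complex set \<Rightarrow> ('a \<Rightarrow> 'a) \<Rightarrow> bool" where
  "slice_function c D f \<longleftrightarrow> (\<exists>F. stem_function D F \<and> induced_by c D F f)"

end

theory Submission imports Defs begin

text \<open>Write \<open>f (\<alpha> + \<beta> J) = a + J b\<close> and let \<open>u\<close> be the inverse of \<open>p = J - K\<close>. The formula
  comes down to \<open>p (u y) = y = u (p y)\<close> for all \<open>y\<close>, that is, to the left multiplications
  \<open>X = L_p\<close> and \<open>Y = L_u\<close> being inverse to each other although multiplication is not associative.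
  Alternativity gives \<open>L_x L_x = L_(x x)\<close>, so \<open>x \<mapsto> L_x\<close> preserves
  anticommutators. Hence \<open>X Y + Y X = 2\<close>, which makes \<open>X\<^sup>2\<close> commute with \<open>Y\<close>, and
  \<open>X\<^sup>2 Y + Y X\<^sup>2 = 2 X\<close>. Therefore \<open>X\<^sup>2 Y = Y X\<^sup>2 = X\<close>, and symmetrically
  \<open>Y\<^sup>2 X = X Y\<^sup>2 = Y\<close>. Evaluating \<open>X Y\<^sup>2 X\<close> in two ways gives \<open>X Y = Y X\<close>, so both are
  the identity.\<close>

lemma alt_minus_left:
  fixes x y :: "'a::unital_real_algebra"
  shows "(- x) * y = - (x * y)"
  using alt_scaleR_left[of "-1" x y] by simp

lemma alt_minus_right:
  fixes x y :: "'a::unital_real_algebra"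
  shows "x * (- y) = - (x * y)"
  using alt_scaleR_right[of x "-1" y] by simp

lemma alt_diff_left:
  fixes x y z :: "'a::unital_real_algebra"
  shows "(x - y) * z = x * z - y * z"
  using alt_distrib_right[of x "- y" z] by (simp add: alt_minus_left)

lemma alt_diff_right:
  fixes x y z :: "'a::unital_real_algebra"
  shows "x * (y - z) = x * y - x * z"
  using alt_distrib_left[of x y "- z"] by (simp add: alt_minus_right)

lemmas alt_bilinear = alt_distrib_left alt_distrib_right alt_diff_left alt_diff_right
  alt_minus_left alt_minus_right alt_scaleR_left alt_scaleR_right alt_one_left alt_one_right

lemma alt_square_left:
  fixes x z :: "'a::real_alternative_algebra"
  shows "x * (x * z) = (x * x) * z"
  using associator_left[of x z] by (simp add: associator_def)

lemma alt_square_right: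
  fixes x z :: "'a::real_alternative_algebra"
  shows "(z * x) * x = z * (x * x)"
  using associator_right[of z x] by (simp add: associator_def)

text \<open>Polarisation: expand \<open>alt_square_left\<close> at \<open>x + y\<close> and cancel
  the instances at \<open>x\<close> and at \<open>y\<close>.\<close>

lemma alt_anticommutator_left:
  fixes x y z :: "'a::real_alternative_algebra"
  shows "x * (y * z) + y * (x * z) = (x * y + y * x) * z"
  using alt_square_left[of "x + y" z] alt_square_left[of x z] alt_square_left[of y z]
  by (simp add: alt_bilinear algebra_simps)

lemma alt_inverse_pair_square:
  fixes x y z :: "'a::real_alternative_algebra"
  assumes "x * y = 1" "y * x = 1"
  shows "x * (x * (y * z)) = x * z" "y * (x * (x * z)) = x * z"
proof -
  have anti: "x * (y * w) + y * (x * w) = w + w" for w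
    using alt_anticommutator_left[of x y w] assms by (simp add: alt_bilinear)
  \<comment> \<open>\<open>anti\<close> at \<open>x * z\<close>, and \<open>x\<close> times
    \<open>anti\<close> at \<open>z\<close>, share the term \<open>x * (y * (x * z))\<close> and
    have the same right-hand side.\<close>
  have comm: "x * (x * (y * z)) = y * (x * (x * z))"
    using anti[of "x * z"] arg_cong[OF anti[of z], of "\<lambda>w. x * w"]
    by (metis alt_distrib_left add.commute add_left_cancel)
  \<comment> \<open>Left alternativity gives \<open>(x * x) * y = x * (x * y)\<close>, right
    alternativity \<open>y * (x * x) = (y * x) * x\<close>; both equal \<open>x\<close>.\<close>
  have "(x * x) * y + y * (x * x) = x + x"
    using alt_square_left[of x y] alt_square_right[of y x] assms by (simp add: alt_bilinear)
  hence "x * (x * (y * z)) + y * (x * (x * z)) = x * z + x * z"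
    using alt_anticommutator_left[of "x * x" y z] by (simp add: alt_square_left alt_bilinear)
  hence "2 *\<^sub>R (x * (x * (y * z))) = 2 *\<^sub>R (x * z)"
    by (simp add: comm scaleR_2)
  thus "x * (x * (y * z)) = x * z" by simp
  thus "y * (x * (x * z)) = x * z" by (simp add: comm)
qed

lemma alt_inverse_pair_cancel:
  fixes x y z :: "'a::real_alternative_algebra"
  assumes "x * y = 1" "y * x = 1"
  shows "x * (y * z) = z"
proof -
  have "x * (y * z) = x * (y * (y * (x * z)))"
    using alt_inverse_pair_square(1)[of y x z] assms by simp
  also have "\<dots> = y * (x * z)"
    using alt_inverse_pair_square(2)[of y x "x * z"] assms by simp
  finally have "x * (y * z) = y * (x * z)" .
  hence "2 *\<^sub>R (x * (y * z)) = 2 *\<^sub>R z"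
    using alt_anticommutator_left[of x y z] assms by (simp add: alt_bilinear scaleR_2)
  thus ?thesis by simp
qed

text \<open>Cancellation makes inverses unique: if \<open>x * z = 1\<close>, then
  \<open>z = y * (x * z) = y\<close>. So the description defining \<open>alt_inverse\<close> is
  proper.\<close>

lemma alt_inverse_mult:
  assumes "alt_invertible x"
  shows "x * alt_inverse x = 1" "alt_inverse x * x = 1"
proof -
  obtain y where y: "x * y = 1" "y * x = 1"
    using assms by (auto simp: alt_invertible_def)
  have "z = y" if "x * z = 1 \<and> z * x = 1" for z
    using alt_inverse_pair_cancel[OF y(2,1), of z] that by (metis alt_one_right)
  with y have "\<exists>!z. x * z = 1 \<and> z * x = 1" by metis
  hence "x * alt_inverse x = 1 \<and> alt_inverse x * x = 1"
    unfolding alt_inverse_def by (rule theI')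
  thus "x * alt_inverse x = 1" "alt_inverse x * x = 1" by blast+
qed

lemma slice_representation:
  fixes J K I a b :: "'a::real_alternative_algebra"
  assumes "alt_invertible (J - K)"
  shows "(I - K) * (alt_inverse (J - K) * (a + J * b))
       - (I - J) * (alt_inverse (J - K) * (a + K * b)) = a + I * b"
proof -
  define u where "u = alt_inverse (J - K)"
  have inv: "(J - K) * u = 1" "u * (J - K) = 1"
    using alt_inverse_mult[OF assms] by (simp_all add: u_def)
  \<comment> \<open>Both cancellation laws are solved for the term with \<open>J\<close>, to serve
    as rewrite rules eliminating \<open>J\<close>. The cross terms \<open>J * (u * (K * b))\<close>
    and \<open>K * (u * (J * b))\<close> both become \<open>K * b + K * (u * (K * b))\<close> and
    cancel.\<close>
  have pu: "J * (u * y) = y + K * (u * y)" for y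
    using alt_inverse_pair_cancel[OF inv, of y] by (simp add: alt_bilinear algebra_simps)
  have up: "u * (J * y) = y + u * (K * y)" for y
    using alt_inverse_pair_cancel[OF inv(2,1), of y] by (simp add: alt_bilinear algebra_simps)
  show ?thesis
    unfolding u_def[symmetric] by (simp add: alt_bilinear pu up)
qed

text \<open>A point of the slice domain may be written with different imaginary units. Its real part
  is fixed and its imaginary coefficient is fixed up to sign, which suffices since \<open>D\<close>
  is closed under conjugation.\<close>

lemma scaleR_one_add_imag_unit_eqD:
  fixes I J :: "'a::real_alternative_algebra"
  assumes "I * I = - 1" "J * J = - 1" "(1::'a) \<noteq> 0"
    and eq: "\<alpha> *\<^sub>R 1 + \<beta> *\<^sub>R I = \<gamma> *\<^sub>R 1 + \<delta> *\<^sub>R J"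
  shows "\<alpha> = \<gamma> \<and> (\<delta> = \<beta> \<or> \<delta> = - \<beta>)"
proof -
  \<comment> \<open>Linear independence of \<open>1\<close> and \<open>J\<close>: squaring
    \<open>s J = - r\<close> gives \<open>r * r + s * s = 0\<close>.\<close>
  have nonreal: "r = 0 \<and> s = 0" if "r *\<^sub>R 1 + s *\<^sub>R J = 0" "J * J = - 1" for r s and J :: 'a
  proof -
    have J: "s *\<^sub>R J = (- r) *\<^sub>R 1"
      using that(1) by (simp add: add_eq_0_iff2 add.commute)
    have "(s *\<^sub>R J) * (s *\<^sub>R J) = - ((s * s) *\<^sub>R 1)"
      by (simp add: alt_bilinear that(2))
    hence "(r * r + s * s) *\<^sub>R (1::'a) = 0"
      unfolding J by (simp add: alt_bilinear scaleR_add_left)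
    thus ?thesis using assms(3) by simp
  qed
  define \<epsilon> where "\<epsilon> = \<gamma> - \<alpha>"
  have I: "\<beta> *\<^sub>R I = \<epsilon> *\<^sub>R 1 + \<delta> *\<^sub>R J"
    using eq by (simp add: \<epsilon>_def algebra_simps)
  \<comment> \<open>Square both sides of \<open>I\<close> and compare the coefficients of
    \<open>1\<close> and \<open>J\<close>.\<close>
  have "- ((\<beta> * \<beta>) *\<^sub>R 1) = (\<beta> *\<^sub>R I) * (\<beta> *\<^sub>R I)"
    by (simp add: alt_bilinear assms(1))
  also have "\<dots> = (\<epsilon> * \<epsilon> - \<delta> * \<delta>) *\<^sub>R 1 + (\<epsilon> * \<delta> + \<epsilon> * \<delta>) *\<^sub>R J"
    unfolding I scaleR_add_left by (simp add: alt_bilinear assms(2) algebra_simps)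
  finally have "(\<epsilon> * \<epsilon> - \<delta> * \<delta> + \<beta> * \<beta>) *\<^sub>R 1 + (\<epsilon> * \<delta> + \<epsilon> * \<delta>) *\<^sub>R J = 0"
    unfolding scaleR_add_left by (simp add: eq_neg_iff_add_eq_0 algebra_simps)
  from nonreal[OF this assms(2)]
  have sq: "\<epsilon> * \<epsilon> - \<delta> * \<delta> + \<beta> * \<beta> = 0" and "\<epsilon> = 0 \<or> \<delta> = 0" by auto
  \<comment> \<open>Here \<beta> I would be the real number \<epsilon>, so independence of
    \<open>1\<close> and \<open>I\<close> applies.\<close>
  moreover have "\<epsilon> = 0" if "\<delta> = 0"
    using nonreal[of "- \<epsilon>" \<beta> I] I that assms(1) by simp
  ultimately have "\<epsilon> = 0" by blast
  with sq show ?thesis by (auto simp: \<epsilon>_def square_eq_iff)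
qed

theorem proposition6:
  fixes c :: "'a::real_alternative_algebra \<Rightarrow> 'a"
    and D :: "complex set"
    and f :: "'a \<Rightarrow> 'a"
  assumes "\<exists>B::'a set. finite B \<and> span B = UNIV"
    and "dim (UNIV :: 'a set) > 1"
    and "antiinvolution c"
    and "imag_units c \<noteq> {}"
    and "open D"
    and "\<forall>z\<in>D. cnj z \<in> D"
    and "slice_function c D f"
  shows "(\<forall>J\<in>imag_units c. \<forall>K\<in>imag_units c. alt_invertible (J - K) \<longrightarrow>
           (\<forall>I\<in>imag_units c. \<forall>x\<in>slice_domain c D \<inter> complex_plane I. \<forall>\<alpha> \<beta>.
              x = \<alpha> *\<^sub>R 1 + \<beta> *\<^sub>R I \<longrightarrow>
              f x = (I - K) * (alt_inverse (J - K) * f (\<alpha> *\<^sub>R 1 + \<beta> *\<^sub>R J))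
                  - (I - J) * (alt_inverse (J - K) * f (\<alpha> *\<^sub>R 1 + \<beta> *\<^sub>R K))))
       \<and> (\<forall>J\<in>imag_units c.
           (\<forall>I\<in>imag_units c. \<forall>x\<in>slice_domain c D \<inter> complex_plane I. \<forall>\<alpha> \<beta>.
              x = \<alpha> *\<^sub>R 1 + \<beta> *\<^sub>R I \<longrightarrow>
              f x = (1/2) *\<^sub>R (f (\<alpha> *\<^sub>R 1 + \<beta> *\<^sub>R J) + f (\<alpha> *\<^sub>R 1 - \<beta> *\<^sub>R J))
                  - ((1/2) *\<^sub>R I) *
                    (J * (f (\<alpha> *\<^sub>R 1 + \<beta> *\<^sub>R J) - f (\<alpha> *\<^sub>R 1 - \<beta> *\<^sub>R J)))))"
proof -
  obtain F where stem: "stem_function D F" and ind: "induced_by c D F f"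
    using assms(7) by (auto simp: slice_function_def)
  \<comment> \<open>If \<open>1 = 0\<close>, the algebra is zero, against dimension greater than
    one.\<close>
  have one_nonzero: "(1::'a) \<noteq> 0"
  proof
    assume "(1::'a) = 0"
    hence "x = 0" for x :: 'a
      using alt_one_left[of x] alt_scaleR_left[of 0 1 x] by simp
    hence "(UNIV :: 'a set) = {0}" by auto
    with assms(2) show False using real_vector.dim_le_card[of "UNIV :: 'a set" "{}"] by simp
  qed
  have sq: "J * J = - 1" if "J \<in> imag_units c" for J
    using that by (simp add: imag_units_def)
  have in_D: "Complex \<alpha> \<beta> \<in> D"
    if I: "I \<in> imag_units c" "\<alpha> *\<^sub>R 1 + \<beta> *\<^sub>R I \<in> slice_domain c D" for \<alpha> \<beta> I
  proof -
    obtain \<gamma> \<delta> J where *: "\<alpha> *\<^sub>R 1 + \<beta> *\<^sub>R I = \<gamma> *\<^sub>R 1 + \<delta> *\<^sub>R J" "Complex \<gamma> \<delta> \<in> D" "J \<in> imag_units c"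
      using I(2) by (auto simp: slice_domain_def)
    have "\<alpha> = \<gamma> \<and> (\<delta> = \<beta> \<or> \<delta> = - \<beta>)"
      by (rule scaleR_one_add_imag_unit_eqD[OF sq[OF I(1)] sq[OF *(3)] one_nonzero *(1)])
    moreover have "cnj (Complex \<gamma> \<delta>) \<in> D" using *(2) assms(6) by blast
    ultimately show ?thesis using *(2) by (auto simp: complex_cnj)
  qed
  have val: "f (\<alpha> *\<^sub>R 1 + \<beta> *\<^sub>R J) = fst (F (Complex \<alpha> \<beta>)) + J * snd (F (Complex \<alpha> \<beta>))"
    if "Complex \<alpha> \<beta> \<in> D" "J \<in> imag_units c" for \<alpha> \<beta> J
    using ind that by (simp add: induced_by_def)
  \<comment> \<open>This is \<open>val\<close> at the conjugate point, where the stem symmetry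
    negates the second component of \<open>F\<close>.\<close>
  have val_cnj: "f (\<alpha> *\<^sub>R 1 - \<beta> *\<^sub>R J) = fst (F (Complex \<alpha> \<beta>)) - J * snd (F (Complex \<alpha> \<beta>))"
    if "Complex \<alpha> \<beta> \<in> D" "J \<in> imag_units c" for \<alpha> \<beta> J
  proof -
    have "cnj (Complex \<alpha> \<beta>) \<in> D" "F (cnj (Complex \<alpha> \<beta>)) = complexified_cnj (F (Complex \<alpha> \<beta>))"
      using assms(6) stem that(1) by (auto simp: stem_function_def)
    thus ?thesis
      using val[of \<alpha> "- \<beta>" J] that(2) by (simp add: complex_cnj complexified_cnj_def alt_bilinear)
  qed
  have JJ: "J * (J * z) = - z" if "J \<in> imag_units c" for J z
    using sq[OF that] by (simp add: alt_square_left alt_bilinear)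
  show ?thesis
  proof (intro conjI ballI allI impI)
    fix J K I x \<alpha> \<beta>
    assume *: "J \<in> imag_units c" "K \<in> imag_units c" "alt_invertible (J - K)" "I \<in> imag_units c"
      "x \<in> slice_domain c D \<inter> complex_plane I" "x = \<alpha> *\<^sub>R 1 + \<beta> *\<^sub>R I"
    hence "Complex \<alpha> \<beta> \<in> D" using in_D by blast
    with * show "f x = (I - K) * (alt_inverse (J - K) * f (\<alpha> *\<^sub>R 1 + \<beta> *\<^sub>R J))
                  - (I - J) * (alt_inverse (J - K) * f (\<alpha> *\<^sub>R 1 + \<beta> *\<^sub>R K))"
      by (simp add: val slice_representation)
  next
    fix J I x \<alpha> \<beta>
    assume *: "J \<in> imag_units c" "I \<in> imag_units c"
      "x \<in> slice_domain c D \<inter> complex_plane I" "x = \<alpha> *\<^sub>R 1 + \<beta> *\<^sub>R I"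
    hence D: "Complex \<alpha> \<beta> \<in> D" using in_D by blast
    \<comment> \<open>The case \<open>K = - J\<close> is computed directly: the half sum of the
      values at \<alpha> + \<beta> J and \<alpha> - \<beta> J is \<open>a\<close>, the half
      difference is \<open>J * b\<close>, and \<open>J * (J * b) = - b\<close>.\<close>
    define a b where "a = fst (F (Complex \<alpha> \<beta>))" and "b = snd (F (Complex \<alpha> \<beta>))"
    have half: "(1/2) *\<^sub>R (z + z) = z" for z :: 'a
      by (simp flip: scaleR_2)
    have "f x = a + I * b" "f (\<alpha> *\<^sub>R 1 + \<beta> *\<^sub>R J) = a + J * b" "f (\<alpha> *\<^sub>R 1 - \<beta> *\<^sub>R J) = a - J * b"
      using * D by (simp_all add: val val_cnj a_def b_def)
    moreover have "((1/2) *\<^sub>R I) * (J * ((a + J * b) - (a - J * b))) = - (I * b)"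
      using half[of "- (I * b)"] by (simp add: alt_bilinear JJ[OF *(1)] scaleR_diff_right)
    moreover have "(1/2) *\<^sub>R ((a + J * b) + (a - J * b)) = a"
      using half[of a] by simp
    ultimately show "f x = (1/2) *\<^sub>R (f (\<alpha> *\<^sub>R 1 + \<beta> *\<^sub>R J) + f (\<alpha> *\<^sub>R 1 - \<beta> *\<^sub>R J))
                  - ((1/2) *\<^sub>R I) *
                    (J * (f (\<alpha> *\<^sub>R 1 + \<beta> *\<^sub>R J) - f (\<alpha> *\<^sub>R 1 - \<beta> *\<^sub>R J)))"
      by (simp only: diff_minus_eq_add)
  qed
qed

end
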